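(* Let $K$ be a finite simplicial complex and $\sigma\in K$ a simplex. If $\sigma$ is not a face simplex of $K$, then $\mathrm{link}_K\,\sigma$ is contractible.
   Context: A simplex $\tau\in K$ is called a face simplex if it can be represented as an intersection $\tau=\sigma_1\cap\dots\cap\sigma_s$ ($s\ge1$) of inclusion-maximal simplices $\sigma_1,\dots,\sigma_s$ of $K$. The link is $\mathrm{link}_K\sigma=\{\tau\in K\mid\tau\cap\sigma=\varnothing,\ \tau\cup\sigma\in K\}$; topological properties refer to geometric realizations. *)

theory Defs
  imports "HOL-Analysis.Analysis"
begin

text \<open>
  A finite abstract simplicial complex is a nonempty finite family of finite sets that is closed
  under taking subsets; in particular the empty simplex always belongs to it.
\<close>

definition finite_abstract_complex :: "'a set set \<Rightarrow> bool" where
  "finite_abstract_complex K \<longleftrightarrow>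
     finite K \<and> K \<noteq> {} \<and> (\<forall>\<sigma>\<in>K. finite \<sigma> \<and> (\<forall>\<tau>. \<tau> \<subseteq> \<sigma> \<longrightarrow> \<tau> \<in> K))"

definition maximal_simplices :: "'a set set \<Rightarrow> 'a set set" where
  "maximal_simplices K = {\<sigma> \<in> K. \<forall>\<tau>\<in>K. \<sigma> \<subseteq> \<tau> \<longrightarrow> \<tau> = \<sigma>}"

definition face_simplex :: "'a set set \<Rightarrow> 'a set \<Rightarrow> bool" where
  "face_simplex K \<tau> \<longleftrightarrow>
     \<tau> \<in> K \<and> (\<exists>F. finite F \<and> F \<noteq> {} \<and> F \<subseteq> maximal_simplices K \<and> \<tau> = \<Inter>F)"

definition simplicial_link :: "'a set set \<Rightarrow> 'a set \<Rightarrow> 'a set set" where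
  "simplicial_link K \<sigma> = {\<tau> \<in> K. \<tau> \<inter> \<sigma> = {} \<and> \<tau> \<union> \<sigma> \<in> K}"

text \<open>
  Points of the geometric realization are given by their barycentric coordinates: nonnegative
  functions on the vertices, with sum one, whose support is a simplex. The product topology is the
  usual topology of the realization because only finite complexes are considered; for infinite
  complexes it may differ from the weak topology.
\<close>

definition geometric_realization :: "'a set set \<Rightarrow> ('a \<Rightarrow> real) topology" where
  "geometric_realization K =
     subtopology (powertop_real UNIV)
       {x. (\<forall>v. 0 \<le> x v) \<and> {v. x v \<noteq> 0} \<in> K \<and> (\<Sum>v | x v \<noteq> 0. x v) = 1}"

text \<open>
  The library predicate \<^const>\<open>contractible_space\<close> also holds for the empty space, which is the
  realization of the complex consisting of the empty simplex only. That space is not contractible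
  in the usual sense, hence the first conjunct.
\<close>

definition contractible_complex :: "'a set set \<Rightarrow> bool" where
  "contractible_complex K \<longleftrightarrow>
     topspace (geometric_realization K) \<noteq> {} \<and> contractible_space (geometric_realization K)"

end

theory Submission
  imports Defs
begin

text \<open>
  If \<open>\<sigma>\<close> is not a face simplex, then the intersection of all maximal simplices containing \<open>\<sigma>\<close>
  has a vertex \<open>v\<close> outside \<open>\<sigma>\<close>. Every simplex of the link can be enlarged by \<open>v\<close>, so the link is a
  cone with apex \<open>v\<close>, and the straight-line homotopy contracts its realization to \<open>v\<close>.
\<close>

lemma maximal_simplex_above:
  assumes "finite_abstract_complex K" and "\<sigma> \<in> K"
  obtains M where "M \<in> maximal_simplices K" and "\<sigma> \<subseteq> M"
proof -
  have "finite K"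
    using assms(1) by (simp add: finite_abstract_complex_def)
  then obtain M where "M \<in> K" "\<sigma> \<subseteq> M" "\<forall>\<tau>\<in>K. M \<subseteq> \<tau> \<longrightarrow> \<tau> = M"
    using finite_has_maximal2[OF _ assms(2)] by blast
  then show thesis
    using that by (simp add: maximal_simplices_def)
qed

lemma finite_abstract_complex_link:
  assumes K: "finite_abstract_complex K" and "\<sigma> \<in> K"
  shows "finite_abstract_complex (simplicial_link K \<sigma>)"
proof -
  have down: "\<And>\<sigma> \<tau>. \<sigma> \<in> K \<Longrightarrow> \<tau> \<subseteq> \<sigma> \<Longrightarrow> \<tau> \<in> K"
    and fin: "finite K" "\<And>\<sigma>. \<sigma> \<in> K \<Longrightarrow> finite \<sigma>"
    using K by (auto simp: finite_abstract_complex_def)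
  have "{} \<in> simplicial_link K \<sigma>"
    using assms(2) down[of \<sigma> "{}"] by (simp add: simplicial_link_def)
  moreover have "\<rho> \<in> simplicial_link K \<sigma>" if "\<tau> \<in> simplicial_link K \<sigma>" "\<rho> \<subseteq> \<tau>" for \<tau> \<rho>
    using that down[of \<tau> \<rho>] down[of "\<tau> \<union> \<sigma>" "\<rho> \<union> \<sigma>"]
    by (auto simp: simplicial_link_def)
  moreover have "finite (simplicial_link K \<sigma>)" "\<And>\<tau>. \<tau> \<in> simplicial_link K \<sigma> \<Longrightarrow> finite \<tau>"
    using fin by (auto simp: simplicial_link_def)
  ultimately show ?thesis
    unfolding finite_abstract_complex_def by blast
qed

text \<open>The case \<open>\<tau> = {}\<close> is included, so \<open>v\<close> is itself a vertex
  of the link. This excludes the link consisting of the empty simplex only, whose realization is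
  empty.\<close>

lemma link_cone_apex:
  assumes K: "finite_abstract_complex K" and \<sigma>: "\<sigma> \<in> K" and "\<not> face_simplex K \<sigma>"
  obtains v where "\<And>\<tau>. \<tau> \<in> simplicial_link K \<sigma> \<Longrightarrow> insert v \<tau> \<in> simplicial_link K \<sigma>"
proof -
  \<comment> \<open>Among all families of maximal simplices containing \<sigma>, this one has the
    smallest intersection. That \<sigma> is not a face simplex is used for this family only.\<close>
  define F where "F = {M \<in> maximal_simplices K. \<sigma> \<subseteq> M}"
  have "finite F"
    using K by (auto simp: F_def maximal_simplices_def finite_abstract_complex_def)
  moreover have "F \<noteq> {}"
    using maximal_simplex_above[OF K \<sigma>] by (auto simp: F_def)
  moreover have "F \<subseteq> maximal_simplices K"
    by (auto simp: F_def)
  ultimately have "\<sigma> \<noteq> \<Inter>F"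
    using assms(3) \<sigma> unfolding face_simplex_def by blast
  moreover have "\<sigma> \<subseteq> \<Inter>F"
    by (auto simp: F_def)
  ultimately obtain v where v: "v \<in> \<Inter>F" "v \<notin> \<sigma>"
    by blast
  show thesis
  proof
    fix \<tau> assume \<tau>: "\<tau> \<in> simplicial_link K \<sigma>"
    then have "\<tau> \<union> \<sigma> \<in> K"
      by (simp add: simplicial_link_def)
    then obtain M where M: "M \<in> maximal_simplices K" "\<tau> \<union> \<sigma> \<subseteq> M"
      using maximal_simplex_above[OF K] by blast
    \<comment> \<open>Since \<open>M\<close> contains \<sigma>, it belongs to \<open>F\<close> and
      hence contains \<open>v\<close>. Thus \<open>M\<close> contains
      \<open>insert v \<tau> \<union> \<sigma>\<close>.\<close>
    then have "v \<in> M" "M \<in> K"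
      using v(1) by (auto simp: F_def maximal_simplices_def)
    then have "insert v \<tau> \<in> K" "insert v \<tau> \<union> \<sigma> \<in> K"
      using K M(2) unfolding finite_abstract_complex_def by auto
    then show "insert v \<tau> \<in> simplicial_link K \<sigma>"
      using \<tau> v(2) by (auto simp: simplicial_link_def)
  qed
qed

text \<open>Enlarging the support to a simplex \<tau> adds only zero terms to the sum. Allowing any
  such \<tau> avoids computing the exact support, which jumps along the homotopy: one simplex then
  serves for all times.\<close>

lemma topspace_geometric_realization_iff:
  assumes L: "finite_abstract_complex L"
  shows "x \<in> topspace (geometric_realization L) \<longleftrightarrow>
    (\<forall>v. 0 \<le> x v) \<and> (\<exists>\<tau>\<in>L. (\<forall>v. v \<notin> \<tau> \<longrightarrow> x v = 0) \<and> sum x \<tau> = 1)"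
proof -
  have "{v. x v \<noteq> 0} \<in> L \<and> (\<Sum>v | x v \<noteq> 0. x v) = 1 \<longleftrightarrow>
      (\<exists>\<tau>\<in>L. (\<forall>v. v \<notin> \<tau> \<longrightarrow> x v = 0) \<and> sum x \<tau> = 1)"
    (is "?A \<longleftrightarrow> ?B")
  proof
    assume ?A
    then show ?B
      by (intro bexI[of _ "{v. x v \<noteq> 0}"]) simp_all
  next
    assume ?B
    then obtain \<tau> where \<tau>: "\<tau> \<in> L" "\<forall>v. v \<notin> \<tau> \<longrightarrow> x v = 0" "sum x \<tau> = 1"
      by blast
    then have sub: "{v. x v \<noteq> 0} \<subseteq> \<tau>"
      by blast
    moreover have "finite \<tau>"
      using L \<tau>(1) by (auto simp: finite_abstract_complex_def)
    ultimately have "(\<Sum>v | x v \<noteq> 0. x v) = sum x \<tau>"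
      by (intro sum.mono_neutral_left) auto
    moreover have "{v. x v \<noteq> 0} \<in> L"
      using L \<tau>(1) sub unfolding finite_abstract_complex_def by blast
    ultimately show ?A
      using \<tau>(3) by simp
  qed
  then show ?thesis
    by (auto simp: geometric_realization_def)
qed

lemma contractible_complex_cone:
  assumes L: "finite_abstract_complex L"
    and cone: "\<And>\<tau>. \<tau> \<in> L \<Longrightarrow> insert v \<tau> \<in> L"
  shows "contractible_complex L"
proof -
  let ?X = "geometric_realization L"
  let ?I = "top_of_set {0..1::real}"
  \<comment> \<open>These are the barycentric coordinates of the vertex \<open>v\<close>.\<close>
  define p :: "'a \<Rightarrow> real" where "p = (\<lambda>w. if w = v then 1 else 0)"
  define h where "h = (\<lambda>(t, x) w. (1 - t) * x w + t * p w)"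
  have "{} \<in> L"
    using L unfolding finite_abstract_complex_def by blast
  then have "{v} \<in> L"
    using cone by blast
  then have "p \<in> topspace ?X"
    by (auto simp: topspace_geometric_realization_iff[OF L] p_def intro!: bexI[of _ "{v}"])
  moreover have h_in: "h (t, x) \<in> topspace ?X"
    if t: "t \<in> {0..1}" and x: "x \<in> topspace ?X" for t x
  proof -
    obtain \<tau> where nonneg: "\<And>w. 0 \<le> x w" and \<tau>: "\<tau> \<in> L" "\<forall>w. w \<notin> \<tau> \<longrightarrow> x w = 0" "sum x \<tau> = 1"
      using x by (auto simp: topspace_geometric_realization_iff[OF L])
    have fin: "finite \<tau>"
      using L \<tau>(1) by (auto simp: finite_abstract_complex_def)
    \<comment> \<open>Either \<open>v\<close> already lies in \<tau>, or the added coordinate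
      \<open>x v\<close> is zero.\<close>
    have "sum x (insert v \<tau>) = 1"
      using \<tau> fin by (cases "v \<in> \<tau>") (auto simp: insert_absorb)
    moreover have "sum p (insert v \<tau>) = 1"
      using fin by (simp add: p_def)
    \<comment> \<open>By linearity the sum is \<open>(1 - t) * 1 + t * 1\<close>. The insertion
      rules are removed so that both sums over \<open>insert v \<tau>\<close> stay intact and match
      the two facts above.\<close>
    ultimately have "sum (h (t, x)) (insert v \<tau>) = 1"
      by (simp add: h_def sum.distrib flip: sum_distrib_left del: sum.insert_if sum.insert)
    moreover have "\<forall>w. 0 \<le> h (t, x) w"
      using t nonneg by (simp add: h_def p_def)
    moreover have "\<forall>w. w \<notin> insert v \<tau> \<longrightarrow> h (t, x) w = 0"
      using \<tau>(2) by (simp add: h_def p_def)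
    ultimately show ?thesis
      using cone[OF \<tau>(1)] unfolding topspace_geometric_realization_iff[OF L] by blast
  qed
  moreover have "continuous_map (prod_topology ?I ?X) ?X h"
  proof -
    \<comment> \<open>The realization is a subspace of a product, so continuity of \<open>h\<close>
      reduces to that of its coordinates, which are polynomial in \<open>t\<close> and
      \<open>x w\<close>. That \<open>h\<close> stays in the subspace is
      \<open>h_in\<close>.\<close>
    have proj: "continuous_map (prod_topology ?I ?X) euclideanreal (\<lambda>z. snd z w)" for w
    proof -
      have "continuous_map ?X euclideanreal (\<lambda>x. x w)"
        unfolding geometric_realization_def
        by (intro continuous_map_from_subtopology continuous_map_product_projection) simp
      then show ?thesis
        using continuous_map_compose[OF continuous_map_snd] by (force simp: o_def)
    qed
    have fst: "continuous_map (prod_topology ?I ?X) euclideanreal fst"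
      using continuous_map_fst[of ?I ?X] continuous_map_into_fulltopology by blast
    have "continuous_map (prod_topology ?I ?X) euclideanreal (\<lambda>z. h z w)" for w
      unfolding h_def case_prod_unfold
      by (intro continuous_map_add continuous_map_real_mult continuous_map_diff fst proj) auto
    then have "continuous_map (prod_topology ?I ?X) (powertop_real UNIV) h"
      by (simp add: continuous_map_componentwise_UNIV)
    moreover have "h \<in> topspace (prod_topology ?I ?X) \<rightarrow> topspace ?X"
      using h_in by auto
    ultimately show ?thesis
      by (simp add: geometric_realization_def continuous_map_in_subtopology image_subset_iff_funcset)
  qed
  ultimately show ?thesis
    \<comment> \<open>The point \<open>p\<close> witnesses nonemptiness and is also the value of the
      constant map; \<open>h\<close> is the identity at time 0 and constantly \<open>p\<close> at
      time 1.\<close>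
    unfolding contractible_complex_def contractible_space_def homotopic_with_def
    by (intro conjI exI[of _ p] exI[of _ h]) (auto simp: h_def)
qed

theorem corollary6:
  fixes K :: "'a set set" and \<sigma> :: "'a set"
  assumes "finite_abstract_complex K"
    and "\<sigma> \<in> K"
    and "\<not> face_simplex K \<sigma>"
  shows "contractible_complex (simplicial_link K \<sigma>)"
proof -
  obtain v where "\<And>\<tau>. \<tau> \<in> simplicial_link K \<sigma> \<Longrightarrow> insert v \<tau> \<in> simplicial_link K \<sigma>"
    using link_cone_apex[OF assms] by blast
  then show ?thesis
    by (rule contractible_complex_cone[OF finite_abstract_complex_link[OF assms(1,2)]])
qed

end
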